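(* For every $\beta\in(0,2)$ with $\beta\neq1$ there exists a positive constant $C_\beta$ depending only on $\beta$ such that $$\int_{\mathbb R}\frac{u^2(y)}{|y|^\beta}\,dy\le C_\beta\,\|u\|^2_{H_0^{\beta/2}(\mathbb R_* )}\qquad\text{for all }u\in H_0^{\beta/2}(\mathbb R_* ).$$ Moreover, these constants can be taken such that $\sup_{\beta\in[\beta_0,\beta_1]}C_\beta<+\infty$ whenever $1<\beta_0<\beta_1<2$.
   Context: $\mathbb R_*=\mathbb R\setminus\{0\}$. For $\beta\in(0,2)$ let $q_\beta(y):=c_\beta|y|^{-1-\beta}$ with $c_\beta:=\frac{2^\beta\Gamma((1+\beta)/2)}{\sqrt\pi|\Gamma(-\beta/2)|}$, and for Borel $u:\mathbb R\to\mathbb R$ let $\mathcal E[u]:=\frac12\int_{\mathbb R^2}[u(y')-u(y)]^2q_\beta(y'-y)\,dy\,dy'\in[0,+\infty]$. $H^{\beta/2}(\mathbb R):=\{u\in L^2(\mathbb R):\mathcal E[u]<\infty\}$ with norm $\|u\|_{H^{\beta/2}(\mathbb R)}:=(\|u\|_{L^2(\mathbb R)}^2+\mathcal E[u])^{1/2}$, and $H_0^{\beta/2}(\mathbb R_* )$ is the completion of $C_c^\infty(\mathbb R_* )$ under this norm (equipped with the same norm, i.e. $\|u\|_{H_0^{\beta/2}(\mathbb R_* )}=\|u\|_{H^{\beta/2}(\mathbb R)}$). *)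

theory Defs
  imports "HOL-Analysis.Analysis"
begin

definition c_const :: "real \<Rightarrow> real" where
  "c_const \<beta> = 2 powr \<beta> * Gamma ((1 + \<beta>) / 2) / (sqrt pi * \<bar>Gamma (- \<beta> / 2)\<bar>)"

(* The value at y = 0 is 0 by the convention 0 powr a = 0; this only concerns the diagonal
   in the energy below, a null set on which the squared increment vanishes anyway. *)
definition q_kernel :: "real \<Rightarrow> real \<Rightarrow> real" where
  "q_kernel \<beta> y = c_const \<beta> * \<bar>y\<bar> powr (- 1 - \<beta>)"

definition energy :: "real \<Rightarrow> (real \<Rightarrow> real) \<Rightarrow> ennreal" where
  "energy \<beta> u =
     (1 / 2) * (\<integral>\<^sup>+ (y, y'). ennreal ((u y' - u y)\<^sup>2 * q_kernel \<beta> (y' - y)) \<partial>(lborel \<Otimes>\<^sub>M lborel))"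

(* Elements of the function spaces are Borel representatives, not classes modulo a.e. equality. *)
definition H_space :: "real \<Rightarrow> (real \<Rightarrow> real) set" where
  "H_space \<beta> = {u \<in> borel_measurable borel.
     integrable lborel (\<lambda>y. (u y)\<^sup>2) \<and> energy \<beta> u < \<infinity>}"

(* Meaningful only on H_space, since enn2real maps \<infinity> to 0. *)
definition H_norm :: "real \<Rightarrow> (real \<Rightarrow> real) \<Rightarrow> real" where
  "H_norm \<beta> u = sqrt ((LINT y|lborel. (u y)\<^sup>2) + enn2real (energy \<beta> u))"

(* Smooth functions with compact support contained in the punctured line,
   extended by zero to the origin. *)
definition Cc_infty_punctured :: "(real \<Rightarrow> real) set" where
  "Cc_infty_punctured = {\<phi>. (\<forall>k x. (deriv ^^ k) \<phi> differentiable (at x)) \<and>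
     compact (closure {x. \<phi> x \<noteq> 0}) \<and> 0 \<notin> closure {x. \<phi> x \<noteq> 0}}"

(* The completion of the test functions, realised inside the complete space H_space as the
   closure of the test functions. For 0 < \<beta> < 2 every test function lies in H_space, hence so
   does the difference u - \<phi> n, and the norm of the difference is the genuine one. *)
definition H0_space :: "real \<Rightarrow> (real \<Rightarrow> real) set" where
  "H0_space \<beta> = {u \<in> H_space \<beta>.
     \<exists>\<phi>. (\<forall>n::nat. \<phi> n \<in> Cc_infty_punctured) \<and>
         (\<lambda>n. H_norm \<beta> (\<lambda>y. u y - \<phi> n y)) \<longlonglongrightarrow> 0}"

end

(* For u with I = \<integral> u\<^sup>2 / \<bar>y\<bar>^\<beta> finite, dilation by t multiplies I by t^(\<beta>-1). As \<beta> \<noteq> 1 this factor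
   stays away from 1 for t in [2, 3], so I is bounded by the weighted integral of
   (u(t y) - u(y))\<^sup>2; averaging over t and substituting z = t y turns that integral into at most a
   multiple of the energy, because \<bar>z - y\<bar> \<le> 2 \<bar>y\<bar> there. Test functions on the punctured line have
   finite I, and the bound passes to their closure after cutting off a neighbourhood of 0, where
   the weight is bounded and L2 convergence suffices. *)
theory Submission
  imports Defs
begin

section \<open>The normalising constant and the kernel\<close>

lemma c_const_pos:
  assumes "0 < \<beta>" "\<beta> < 2"
  shows "0 < c_const \<beta>"
proof -
  \<comment> \<open>\<open>Gamma\<close> takes the value 0 exactly at its poles, the nonpositive
    integers, and here the argument lies strictly between -1 and 0.\<close>
  have "Gamma (- \<beta> / 2) \<noteq> 0"
    using assms by (auto simp: Gamma_eq_zero_iff elim!: nonpos_Ints_cases')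
  then show ?thesis
    using assms by (auto simp: c_const_def intro!: mult_pos_pos divide_pos_pos Gamma_real_pos)
qed

text \<open>Serves the uniformity claim: constants that depend continuously on \<beta> are bounded
  on compact intervals.\<close>

lemma continuous_on_c_const:
  assumes "A \<subseteq> {0<..<2}"
  shows "continuous_on A c_const"
proof -
  have *: "- \<beta> / 2 \<notin> \<int>\<^sub>\<le>\<^sub>0" "(1 + \<beta>) / 2 \<notin> \<int>\<^sub>\<le>\<^sub>0" if "\<beta> \<in> A" for \<beta>
    using that assms by (force elim!: nonpos_Ints_cases')+
  show ?thesis
    unfolding continuous_on_def c_const_def[abs_def]
    by (intro ballI tendsto_intros) (use * in \<open>auto simp: Gamma_eq_zero_iff\<close>)
qed

lemma q_kernel_measurable [measurable]: "q_kernel \<beta> \<in> borel_measurable borel"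
  unfolding q_kernel_def[abs_def] by measurable

lemma q_kernel_nonneg: "0 < \<beta> \<Longrightarrow> \<beta> < 2 \<Longrightarrow> 0 \<le> q_kernel \<beta> y"
  using c_const_pos[of \<beta>] by (simp add: q_kernel_def)

lemma energy_iterated:
  assumes [measurable]: "u \<in> borel_measurable borel"
  shows "energy \<beta> u =
    (1 / 2) * (\<integral>\<^sup>+ y. \<integral>\<^sup>+ y'. ennreal ((u y' - u y)\<^sup>2 * q_kernel \<beta> (y' - y)) \<partial>lborel \<partial>lborel)"
  unfolding energy_def by (subst lborel.nn_integral_fst [symmetric]) auto

section \<open>Quadratic comparisons and differences in the energy\<close>

lemma square_add_le: "(a + b)\<^sup>2 \<le> 2 * a\<^sup>2 + 2 * (b::real)\<^sup>2"
  using zero_le_power2[of "a - b"] by (simp add: power2_eq_square algebra_simps)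

lemma square_diff_le: "(a - b)\<^sup>2 \<le> 2 * a\<^sup>2 + 2 * (b::real)\<^sup>2"
  using square_add_le[of a "- b"] by simp

text \<open>Pointwise estimates are proved in the reals, where ring simplification works; this
  carries them over to \<open>ennreal\<close> integrals.\<close>

lemma nn_integral_le_lincomb:
  fixes f g h :: "'a \<Rightarrow> real"
  assumes [measurable]: "g \<in> borel_measurable M" "h \<in> borel_measurable M"
    and "\<And>x. 0 \<le> g x" "\<And>x. 0 \<le> h x" "0 \<le> a" "0 \<le> b"
    and "\<And>x. x \<in> space M \<Longrightarrow> f x \<le> a * g x + b * h x"
  shows "(\<integral>\<^sup>+ x. ennreal (f x) \<partial>M) \<le> ennreal a * (\<integral>\<^sup>+ x. ennreal (g x) \<partial>M) + ennreal b * (\<integral>\<^sup>+ x. ennreal (h x) \<partial>M)"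
proof -
  have "(\<integral>\<^sup>+ x. ennreal (f x) \<partial>M) \<le> (\<integral>\<^sup>+ x. ennreal a * ennreal (g x) + ennreal b * ennreal (h x) \<partial>M)"
    using assms by (intro nn_integral_mono)
      (simp add: ennreal_leI flip: ennreal_mult ennreal_plus)
  then show ?thesis
    by (simp add: nn_integral_add nn_integral_cmult)
qed

lemma energy_diff_le:
  assumes "0 < \<beta>" "\<beta> < 2"
    and [measurable]: "u \<in> borel_measurable borel" "v \<in> borel_measurable borel"
  shows "energy \<beta> (\<lambda>y. u y - v y) \<le> 2 * energy \<beta> u + 2 * energy \<beta> v"
proof -
  let ?M = "lborel \<Otimes>\<^sub>M lborel :: (real \<times> real) measure"
  let ?e = "\<lambda>w p. (w (snd p) - w (fst p))\<^sup>2 * q_kernel \<beta> (snd p - fst p)"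
  have energy: "energy \<beta> w = (1 / 2) * (\<integral>\<^sup>+ p. ennreal (?e w p) \<partial>?M)" for w
    by (simp add: energy_def case_prod_beta')
  have *: "?e (\<lambda>y. u y - v y) p \<le> 2 * ?e u p + 2 * ?e v p" for p
    using mult_right_mono[OF square_diff_le[of "u (snd p) - u (fst p)" "v (snd p) - v (fst p)"]
        q_kernel_nonneg[OF assms(1,2), of "snd p - fst p"]]
    by (simp add: algebra_simps)
  have "(\<integral>\<^sup>+ p. ennreal (?e (\<lambda>y. u y - v y) p) \<partial>?M)
      \<le> 2 * (\<integral>\<^sup>+ p. ennreal (?e u p) \<partial>?M) + 2 * (\<integral>\<^sup>+ p. ennreal (?e v p) \<partial>?M)"
    using nn_integral_le_lincomb[of "?e u" ?M "?e v" 2 2 "?e (\<lambda>y. u y - v y)"] *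
    by (simp add: q_kernel_nonneg[OF assms(1,2)])
  from mult_left_mono[OF this, of "1 / 2"] show ?thesis
    unfolding energy by (simp add: distrib_left mult.left_commute)
qed

section \<open>The dilation argument for functions with finite weighted integral\<close>

lemma nn_integral_dilation:
  fixes u :: "real \<Rightarrow> real"
  assumes [measurable]: "u \<in> borel_measurable borel" and "0 < t"
  shows "(\<integral>\<^sup>+ y. ennreal ((u (t * y))\<^sup>2 / \<bar>y\<bar> powr \<beta>) \<partial>lborel)
    = ennreal (t powr (\<beta> - 1)) * (\<integral>\<^sup>+ y. ennreal ((u y)\<^sup>2 / \<bar>y\<bar> powr \<beta>) \<partial>lborel)"
proof -
  have eq: "t powr (\<beta> - 1) * (t * ((u (t * y))\<^sup>2 / \<bar>t * y\<bar> powr \<beta>)) = (u (t * y))\<^sup>2 / \<bar>y\<bar> powr \<beta>" for y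
    using \<open>0 < t\<close> by (simp add: powr_mult abs_mult powr_diff)
  have "(\<integral>\<^sup>+ y. ennreal ((u y)\<^sup>2 / \<bar>y\<bar> powr \<beta>) \<partial>lborel)
      = ennreal t * (\<integral>\<^sup>+ y. ennreal ((u (t * y))\<^sup>2 / \<bar>t * y\<bar> powr \<beta>) \<partial>lborel)"
    using nn_integral_real_affine[of "\<lambda>y. ennreal ((u y)\<^sup>2 / \<bar>y\<bar> powr \<beta>)" t 0] \<open>0 < t\<close> by simp
  also have "ennreal (t powr (\<beta> - 1)) * \<dots>
      = (\<integral>\<^sup>+ y. ennreal (t powr (\<beta> - 1)) * (ennreal t * ennreal ((u (t * y))\<^sup>2 / \<bar>t * y\<bar> powr \<beta>)) \<partial>lborel)"
    by (simp add: nn_integral_cmult)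
  also have "\<dots> = (\<integral>\<^sup>+ y. ennreal ((u (t * y))\<^sup>2 / \<bar>y\<bar> powr \<beta>) \<partial>lborel)"
    using \<open>0 < t\<close> by (intro nn_integral_cong, subst eq [symmetric])
      (simp add: ennreal_mult del: times_divide_eq_right)
  finally show ?thesis by simp
qed

text \<open>Young's inequality for a = b + (a - b): the two sides differ by a perfect square over d.
  A small d brings the coefficient of b^2 close to 1, below the dilation factor it has to compete
  with.\<close>

lemma square_le_weighted:
  fixes a b d :: real
  assumes "0 < d"
  shows "a\<^sup>2 \<le> (1 + d) * b\<^sup>2 + (1 + 1 / d) * (a - b)\<^sup>2"
proof -
  have "(1 + d) * b\<^sup>2 + (1 + 1 / d) * (a - b)\<^sup>2 - a\<^sup>2 = (d * b - (a - b))\<^sup>2 / d"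
    using assms by (simp add: field_simps power2_eq_square)
  then show ?thesis
    using assms by (smt (verit) divide_nonneg_pos zero_le_power2)
qed

text \<open>The dilation factor t^(\<beta>-1) or its inverse is at least m = 2^\<bar>\<beta>-1\<bar>
  > 1. Young's inequality is applied in the direction that puts the larger of the two integrals, of
  u(t y) and of u(y), on the left; finiteness then allows the smaller one to be absorbed.\<close>

lemma nn_integral_dilation_diff_ge:
  fixes u :: "real \<Rightarrow> real"
  assumes [measurable]: "u \<in> borel_measurable borel"
    and \<beta>: "0 < \<beta>" "\<beta> < 2" "\<beta> \<noteq> 1" and t: "2 \<le> t" "t \<le> 3"
    and fin: "(\<integral>\<^sup>+ y. ennreal ((u y)\<^sup>2 / \<bar>y\<bar> powr \<beta>) \<partial>lborel) < \<infinity>"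
  shows "(\<integral>\<^sup>+ y. ennreal ((u y)\<^sup>2 / \<bar>y\<bar> powr \<beta>) \<partial>lborel)
    \<le> ennreal (18 / (2 powr \<bar>\<beta> - 1\<bar> - 1)\<^sup>2)
      * (\<integral>\<^sup>+ y. ennreal ((u (t * y) - u y)\<^sup>2 / \<bar>y\<bar> powr \<beta>) \<partial>lborel)"
proof -
  define m where "m = 2 powr \<bar>\<beta> - 1\<bar>"
  have m: "1 < m" "m \<le> 2"
    using \<beta> powr_mono[of "\<bar>\<beta> - 1\<bar>" 1 2] by (auto simp: m_def)
  \<comment> \<open>This puts 1 + d halfway between 1 and m, so that absorption leaves m - (1 + d) =
    d as the coefficient of the weighted integral.\<close>
  define d where "d = (m - 1) / 2"
  have d: "0 < d" "d \<le> 1 / 2" using m by (auto simp: d_def)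
  let ?I = "\<integral>\<^sup>+ y. ennreal ((u y)\<^sup>2 / \<bar>y\<bar> powr \<beta>) \<partial>lborel"
  let ?D = "\<integral>\<^sup>+ y. ennreal ((u (t * y) - u y)\<^sup>2 / \<bar>y\<bar> powr \<beta>) \<partial>lborel"
  have dil: "(\<integral>\<^sup>+ y. ennreal ((u (t * y))\<^sup>2 / \<bar>y\<bar> powr \<beta>) \<partial>lborel) = ennreal (t powr (\<beta> - 1)) * ?I"
    using t by (intro nn_integral_dilation) auto
  have weighted: "a\<^sup>2 / w \<le> (1 + d) * (b\<^sup>2 / w) + (1 + 1 / d) * (c\<^sup>2 / w)"
    if "0 \<le> w" "c\<^sup>2 = (a - b)\<^sup>2" for a b c w :: real
    using divide_right_mono[OF square_le_weighted[OF d(1), of a b] that(1)] that(2)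
    by (simp add: add_divide_distrib)
  show ?thesis
  \<comment> \<open>An infinite \<open>?D\<close> makes the right side infinite, its factor being
    positive. Otherwise both integrals are real numbers and may be subtracted.\<close>
  proof (cases "?D = \<infinity>")
    case True
    then show ?thesis using m by (simp add: m_def[symmetric] ennreal_mult_top)
  next
    case False
    obtain i where i: "0 \<le> i" "?I = ennreal i"
      using fin by (cases ?I) auto
    obtain D where D: "0 \<le> D" "?D = ennreal D"
      using False by (cases ?D) auto
    have "ennreal (t powr (\<beta> - 1)) * ?I \<le> ennreal (1 + d) * ?I + ennreal (1 + 1 / d) * ?D"
      unfolding dil [symmetric] using d
      by (intro nn_integral_le_lincomb weighted) auto
    then have up: "t powr (\<beta> - 1) * i \<le> (1 + d) * i + (1 + 1 / d) * D"
      unfolding i D using i D d by (simp flip: ennreal_mult ennreal_plus)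
    \<comment> \<open>The same estimate with the roles of u(t y) and u(y) exchanged; this one is
      effective for \<beta> < 1.\<close>
    have "?I \<le> ennreal (1 + d) * (ennreal (t powr (\<beta> - 1)) * ?I) + ennreal (1 + 1 / d) * ?D"
      unfolding dil [symmetric] using d
      by (intro nn_integral_le_lincomb weighted) (auto simp: power2_commute)
    then have "i \<le> (1 + d) * (t powr (\<beta> - 1) * i) + (1 + 1 / d) * D"
      unfolding i D using i D d by (simp flip: ennreal_mult ennreal_plus)
    from mult_left_mono[OF this, of "t powr (1 - \<beta>)"]
    have down: "t powr (1 - \<beta>) * i \<le> (1 + d) * i + t powr (1 - \<beta>) * ((1 + 1 / d) * D)"
      using t by (simp add: algebra_simps flip: powr_add)
    \<comment> \<open>The 3 pays for t^(1-\<beta>) \<le> t \<le> 3, the factor that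
      \<open>down\<close> puts on D when \<beta> < 1; for \<beta> > 1 it is slack.\<close>
    have "m * i \<le> (1 + d) * i + 3 * ((1 + 1 / d) * D)"
    proof (cases "1 < \<beta>")
      case True
      have "m \<le> t powr (\<beta> - 1)"
        using True t by (auto simp: m_def intro!: powr_mono2)
      then have "m * i \<le> t powr (\<beta> - 1) * i" using i by (intro mult_right_mono)
      moreover have "0 \<le> (1 + 1 / d) * D" using d D by simp
      ultimately show ?thesis using up by linarith
    next
      case False
      have "m \<le> t powr (1 - \<beta>)"
        using False t by (auto simp: m_def intro!: powr_mono2)
      then have 1: "m * i \<le> t powr (1 - \<beta>) * i" using i by (intro mult_right_mono)
      have "t powr (1 - \<beta>) \<le> t powr 1"
        using t \<beta> by (intro powr_mono) auto
      then have "t powr (1 - \<beta>) \<le> 3" using t by simp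
      then have "t powr (1 - \<beta>) * ((1 + 1 / d) * D) \<le> 3 * ((1 + 1 / d) * D)"
        using d D by (intro mult_right_mono) auto
      with down 1 show ?thesis by linarith
    qed
    moreover have "m * i = i + 2 * (d * i)" "(1 + d) * i = i + d * i"
      by (auto simp: d_def field_simps)
    ultimately have "d * i \<le> 3 * ((1 + 1 / d) * D)"
      by linarith
    then have "i \<le> 3 * (1 + d) / d\<^sup>2 * D"
      using d by (simp add: field_simps power2_eq_square)
    \<comment> \<open>From d \<le> 1/2, which holds because m \<le> 2. Inserting d = (m - 1)/2 next
      turns 9/2 into 18.\<close>
    also have "\<dots> \<le> (9 / 2) / d\<^sup>2 * D"
      using d D by (intro mult_right_mono divide_right_mono) auto
    also have "\<dots> = 18 / (m - 1)\<^sup>2 * D"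
      by (simp add: d_def power_divide)
    finally have "i \<le> 18 / (m - 1)\<^sup>2 * D" .
    then show ?thesis
      using D i by (simp add: m_def flip: ennreal_mult)
  qed
qed

text \<open>By Fubini the t-integral is taken first, at fixed y. The substitution z = y t has
  Jacobian \<bar>y\<bar>, which accounts for the gap between the weight \<bar>y\<bar>^(-\<beta>) and
  the kernel exponent -1-\<beta>; afterwards z is allowed to range over the whole line.\<close>

lemma nn_integral_dilation_diff_le:
  fixes u :: "real \<Rightarrow> real"
  assumes [measurable]: "u \<in> borel_measurable borel"
    and \<beta>: "0 < \<beta>" "\<beta> < 2"
  shows "(\<integral>\<^sup>+ t. indicator {2..3} t * (\<integral>\<^sup>+ y. ennreal ((u (t * y) - u y)\<^sup>2 / \<bar>y\<bar> powr \<beta>) \<partial>lborel) \<partial>lborel)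
    \<le> ennreal (16 / c_const \<beta>) * energy \<beta> u"
proof -
  let ?c = "c_const \<beta>"
  have c: "0 < ?c" using c_const_pos[OF \<beta>] .
  let ?F = "\<lambda>t y. indicator {2..3} t * ennreal ((u (t * y) - u y)\<^sup>2 / \<bar>y\<bar> powr \<beta>)"
  have pointwise: "(u (y * t) - u y)\<^sup>2 / \<bar>y\<bar> powr \<beta>
      \<le> \<bar>y\<bar> * (8 / ?c * ((u (y * t) - u y)\<^sup>2 * q_kernel \<beta> (y * t - y)))"
    if "y \<noteq> 0" "2 \<le> t" "t \<le> 3" for y t :: real
  proof -
    \<comment> \<open>The factor \<bar>y\<bar> split off here is the Jacobian consumed in
      \<open>inner\<close>.\<close>
    have pw: "\<bar>y\<bar> powr (- \<beta>) = \<bar>y\<bar> * \<bar>y\<bar> powr (- 1 - \<beta>)"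
      using that by (simp add: powr_mult_base)
    have "\<bar>y * t - y\<bar> = (t - 1) * \<bar>y\<bar>"
      using that abs_mult[of y "t - 1"] by (simp add: algebra_simps)
    moreover have "(t - 1) * \<bar>y\<bar> \<le> 2 * \<bar>y\<bar>" "0 < (t - 1) * \<bar>y\<bar>"
      using that by (auto intro!: mult_right_mono)
    ultimately have "(2 * \<bar>y\<bar>) powr (- 1 - \<beta>) \<le> \<bar>y * t - y\<bar> powr (- 1 - \<beta>)"
      using \<beta> by (intro powr_mono2') auto
    moreover have "(2 * \<bar>y\<bar>) powr (- 1 - \<beta>) = 2 powr (- 1 - \<beta>) * \<bar>y\<bar> powr (- 1 - \<beta>)"
      by (simp add: powr_mult)
    moreover have "1 / 8 * \<bar>y\<bar> powr (- 1 - \<beta>) \<le> 2 powr (- 1 - \<beta>) * \<bar>y\<bar> powr (- 1 - \<beta>)"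
    proof (rule mult_right_mono)
      \<comment> \<open>Bounding the exponent through \<beta> < 2 gives the constant 8, independent
        of \<beta>.\<close>
      have "2 powr (- 3) \<le> (2::real) powr (- 1 - \<beta>)"
        using \<beta> by (intro powr_mono) auto
      then show "1 / 8 \<le> (2::real) powr (- 1 - \<beta>)"
        by (simp add: powr_minus)
    qed auto
    ultimately have "\<bar>y\<bar> powr (- 1 - \<beta>) \<le> 8 * \<bar>y * t - y\<bar> powr (- 1 - \<beta>)"
      by linarith
    then have "\<bar>y\<bar> powr (- \<beta>) \<le> \<bar>y\<bar> * (8 * \<bar>y * t - y\<bar> powr (- 1 - \<beta>))"
      unfolding pw by (intro mult_left_mono) auto
    from mult_left_mono[OF this, of "(u (y * t) - u y)\<^sup>2"]
    show ?thesis
      using c by (simp add: q_kernel_def powr_minus_divide mult_ac)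
  qed
  have inner: "(\<integral>\<^sup>+ t. ?F t y \<partial>lborel)
      \<le> ennreal (8 / ?c) * (\<integral>\<^sup>+ z. ennreal ((u z - u y)\<^sup>2 * q_kernel \<beta> (z - y)) \<partial>lborel)" for y
  \<comment> \<open>Dilations fix the origin, so the left side vanishes at y = 0; elsewhere t
    \<mapsto> y t is an admissible substitution. The terms \<open>0 + y * t\<close> below have the
    affine form of the substitution rule.\<close>
  proof (cases "y = 0")
    case True
    then show ?thesis by simp
  next
    case False
    have "(\<integral>\<^sup>+ t. ?F t y \<partial>lborel)
        \<le> (\<integral>\<^sup>+ t. ennreal \<bar>y\<bar> * (ennreal (8 / ?c) * ennreal ((u (0 + y * t) - u y)\<^sup>2 * q_kernel \<beta> (0 + y * t - y))) \<partial>lborel)"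
    proof (intro nn_integral_mono)
      fix t :: real
      show "?F t y \<le> ennreal \<bar>y\<bar> * (ennreal (8 / ?c) * ennreal ((u (0 + y * t) - u y)\<^sup>2 * q_kernel \<beta> (0 + y * t - y)))"
        using ennreal_leI[OF pointwise[OF False, of t]] c q_kernel_nonneg[OF \<beta>, of "y * t - y"]
        by (auto simp: indicator_def mult.commute[of t y] simp del: times_divide_eq_left times_divide_eq_right
            simp flip: ennreal_mult)
    qed
    also have "\<dots> = ennreal (8 / ?c) * (\<integral>\<^sup>+ z. ennreal ((u z - u y)\<^sup>2 * q_kernel \<beta> (z - y)) \<partial>lborel)"
      by (subst nn_integral_real_affine[of "\<lambda>z. ennreal ((u z - u y)\<^sup>2 * q_kernel \<beta> (z - y))" y 0])
        (use False in \<open>auto simp: nn_integral_cmult mult.left_commute\<close>)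
    finally show ?thesis .
  qed
  have "(\<integral>\<^sup>+ t. indicator {2..3} t * (\<integral>\<^sup>+ y. ennreal ((u (t * y) - u y)\<^sup>2 / \<bar>y\<bar> powr \<beta>) \<partial>lborel) \<partial>lborel)
      = (\<integral>\<^sup>+ t. \<integral>\<^sup>+ y. ?F t y \<partial>lborel \<partial>lborel)"
    by (simp add: nn_integral_cmult)
  also have "\<dots> = (\<integral>\<^sup>+ y. \<integral>\<^sup>+ t. ?F t y \<partial>lborel \<partial>lborel)"
    by (rule lborel_pair.Fubini' [symmetric]) measurable
  also have "\<dots> \<le> (\<integral>\<^sup>+ y. ennreal (8 / ?c) * (\<integral>\<^sup>+ z. ennreal ((u z - u y)\<^sup>2 * q_kernel \<beta> (z - y)) \<partial>lborel) \<partial>lborel)"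
    by (intro nn_integral_mono inner)
  also have "\<dots> = ennreal (8 / ?c) * (\<integral>\<^sup>+ y. \<integral>\<^sup>+ z. ennreal ((u z - u y)\<^sup>2 * q_kernel \<beta> (z - y)) \<partial>lborel \<partial>lborel)"
    by (simp add: nn_integral_cmult)
  \<comment> \<open>The 2 undoes the factor 1/2 in \<open>energy\<close>, whence 16 = 2 * 8.\<close>
  also have "\<dots> = ennreal (8 / ?c) * (2 * energy \<beta> u)"
  proof -
    have "2 * (1 / 2) = (1 :: ennreal)" by (simp add: ennreal_times_divide)
    then show ?thesis by (simp add: energy_iterated flip: mult.assoc del: times_divide_eq_right)
  qed
  also have "\<dots> = ennreal (16 / ?c) * energy \<beta> u"
  proof -
    have "ennreal (8 / ?c) * 2 = ennreal (8 / ?c * 2)"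
      using c by (subst ennreal_mult) auto
    then show ?thesis by (simp add: mult.assoc [symmetric])
  qed
  finally show ?thesis .
qed

lemma hardy_of_finite:
  fixes u :: "real \<Rightarrow> real"
  assumes [measurable]: "u \<in> borel_measurable borel"
    and \<beta>: "0 < \<beta>" "\<beta> < 2" "\<beta> \<noteq> 1"
    and fin: "(\<integral>\<^sup>+ y. ennreal ((u y)\<^sup>2 / \<bar>y\<bar> powr \<beta>) \<partial>lborel) < \<infinity>"
  shows "(\<integral>\<^sup>+ y. ennreal ((u y)\<^sup>2 / \<bar>y\<bar> powr \<beta>) \<partial>lborel)
    \<le> ennreal (288 / ((2 powr \<bar>\<beta> - 1\<bar> - 1)\<^sup>2 * c_const \<beta>)) * energy \<beta> u"
proof -
  let ?I = "\<integral>\<^sup>+ y. ennreal ((u y)\<^sup>2 / \<bar>y\<bar> powr \<beta>) \<partial>lborel"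
  let ?k = "18 / (2 powr \<bar>\<beta> - 1\<bar> - 1)\<^sup>2"
  let ?D = "\<lambda>t. \<integral>\<^sup>+ y. ennreal ((u (t * y) - u y)\<^sup>2 / \<bar>y\<bar> powr \<beta>) \<partial>lborel"
  have c: "0 < c_const \<beta>" using c_const_pos \<beta> by simp
  \<comment> \<open>The interval [2, 3] has length 1, so averaging over it needs no normalisation.
    The final constant is 288 = 18 * 16.\<close>
  have "?I = (\<integral>\<^sup>+ t. ?I * indicator {2..3::real} t \<partial>lborel)"
    by (subst nn_integral_cmult_indicator) auto
  also have "\<dots> \<le> (\<integral>\<^sup>+ t. ennreal ?k * (indicator {2..3} t * ?D t) \<partial>lborel)"
    using nn_integral_dilation_diff_ge[OF assms(1) \<beta> _ _ fin]
    by (intro nn_integral_mono) (auto simp: indicator_def)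
  also have "\<dots> = ennreal ?k * (\<integral>\<^sup>+ t. indicator {2..3} t * ?D t \<partial>lborel)"
    by (simp add: nn_integral_cmult)
  also have "\<dots> \<le> ennreal ?k * (ennreal (16 / c_const \<beta>) * energy \<beta> u)"
    using \<beta> by (intro mult_left_mono nn_integral_dilation_diff_le) auto
  also have "\<dots> = ennreal (288 / ((2 powr \<bar>\<beta> - 1\<bar> - 1)\<^sup>2 * c_const \<beta>)) * energy \<beta> u"
    using c by (simp add: mult.assoc [symmetric] flip: ennreal_mult)
  finally show ?thesis .
qed


section \<open>Test functions: finite weighted integral and finite energy\<close>

lemma nn_integral_bounded_support_finite:
  fixes f :: "real \<Rightarrow> real"
  assumes "\<And>y. \<bar>f y\<bar> \<le> B * indicator {-R..R} y" 
  shows "(\<integral>\<^sup>+ y. ennreal (f y) \<partial>lborel) < \<infinity>"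
proof -
  have "0 \<le> B * indicator {-R..R} y" for y
    using assms[of y] by linarith
  then have "ennreal (f y) \<le> ennreal B * indicator {-R..R} y" for y
    using ennreal_leI[of "f y" "B * indicator {-R..R} y"] assms[of y]
    by (auto simp: indicator_def split: if_splits)
  then have "(\<integral>\<^sup>+ y. ennreal (f y) \<partial>lborel) \<le> (\<integral>\<^sup>+ y. ennreal B * indicator {-R..R} y \<partial>lborel)"
    by (intro nn_integral_mono)
  also have "\<dots> = ennreal B * emeasure lborel {-R..R}"
    by (rule nn_integral_cmult_indicator) simp
  also have "\<dots> < \<infinity>"
    by (cases "-R \<le> R") (auto simp: ennreal_mult_less_top)
  finally show ?thesis .
qed

text \<open>The gap r tames the weight at the origin, R and M give integrability, and the Lipschitz
  constant L tames the kernel on the diagonal. L comes from the mean value inequality: the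
  derivative is continuous and vanishes off a compact set.\<close>

lemma Cc_infty_puncturedE:
  assumes "\<phi> \<in> Cc_infty_punctured"
  obtains r R M L where "0 < r" "0 < R" "0 \<le> M" "0 \<le> L"
    "\<And>y. \<bar>y\<bar> < r \<Longrightarrow> \<phi> y = 0" "\<And>y. R < \<bar>y\<bar> \<Longrightarrow> \<phi> y = 0" "\<And>y. \<bar>\<phi> y\<bar> \<le> M"
    "\<And>x y. \<bar>\<phi> x - \<phi> y\<bar> \<le> L * \<bar>x - y\<bar>"
proof -
  define S where "S = closure {x. \<phi> x \<noteq> 0}"
  have S: "compact S" "0 \<notin> S" and diff: "\<And>k x. (deriv ^^ k) \<phi> differentiable (at x)"
    using assms by (auto simp: Cc_infty_punctured_def S_def)
  have zero: "\<phi> y = 0" if "y \<notin> S" for y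
    using that closure_subset[of "{x. \<phi> x \<noteq> 0}"] by (auto simp: S_def)
  obtain R where R: "0 < R" "\<And>y. y \<in> S \<Longrightarrow> \<bar>y\<bar> \<le> R"
    using compact_imp_bounded[OF S(1)] by (auto simp: bounded_pos)
  have "open (- S)" using compact_imp_closed[OF S(1)] by (simp add: open_Compl)
  then obtain r where r: "0 < r" "ball 0 r \<subseteq> - S"
    using S(2) by (meson ComplI open_contains_ball)
  have d0: "\<phi> differentiable (at x)" and d1: "deriv \<phi> differentiable (at x)" for x
    using diff[of 0 x] diff[of 1 x] by auto
  have der: "(\<phi> has_real_derivative deriv \<phi> x) (at x)" for x
    using d0[of x] DERIV_deriv_iff_real_differentiable by blast
  have cont: "continuous_on A \<phi>" "continuous_on A (deriv \<phi>)" for A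
    using d0 d1 by (auto intro!: continuous_at_imp_continuous_on differentiable_imp_continuous_within)
  have "deriv \<phi> y = 0" if "y \<notin> S" for y
  proof -
    \<comment> \<open>The complement of S is open, so \<phi> agrees with 0 on a neighbourhood of
      y.\<close>
    have "(\<phi> has_real_derivative 0) (at y) \<longleftrightarrow> ((\<lambda>_. 0) has_real_derivative 0) (at y)"
      using that \<open>open (- S)\<close> zero by (intro DERIV_cong_ev) (auto simp: eventually_nhds)
    then show ?thesis by (auto intro: DERIV_imp_deriv)
  qed
  moreover
  have "bounded (\<phi> ` S)" "bounded (deriv \<phi> ` S)"
    using S cont by (auto intro!: compact_imp_bounded compact_continuous_image)
  then obtain M L where bd: "0 < M" "0 < L" "\<And>y. y \<in> S \<Longrightarrow> \<bar>\<phi> y\<bar> \<le> M" "\<And>y. y \<in> S \<Longrightarrow> \<bar>deriv \<phi> y\<bar> \<le> L"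
    unfolding bounded_pos by auto
  ultimately have "\<bar>deriv \<phi> y\<bar> \<le> L" for y by (cases "y \<in> S") auto
  then have "\<bar>\<phi> x - \<phi> y\<bar> \<le> L * \<bar>x - y\<bar>" for x y
    using field_differentiable_bound[of UNIV \<phi> "deriv \<phi>" L x y] der by auto
  moreover have "\<bar>\<phi> y\<bar> \<le> M" for y
    using bd zero[of y] by (cases "y \<in> S") auto
  moreover have "\<phi> y = 0" if "\<bar>y\<bar> < r" for y
    using r that zero by (auto simp: subset_iff)
  moreover have "\<phi> y = 0" if "R < \<bar>y\<bar>" for y
    using R(2)[of y] that zero by force
  ultimately show thesis
    using that[of r R M L] r R bd by auto
qed

lemma Cc_infty_punctured_measurable:
  assumes "\<phi> \<in> Cc_infty_punctured"
  shows "\<phi> \<in> borel_measurable borel"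
proof -
  have "\<phi> differentiable (at x)" for x
    using assms by (auto simp: Cc_infty_punctured_def dest!: spec[of _ "0::nat"])
  then show ?thesis
    by (intro borel_measurable_continuous_onI)
      (auto intro!: continuous_at_imp_continuous_on differentiable_imp_continuous_within)
qed

lemma Cc_infty_punctured_L2:
  assumes "\<phi> \<in> Cc_infty_punctured"
  shows "(\<integral>\<^sup>+ y. ennreal ((\<phi> y)\<^sup>2) \<partial>lborel) < \<infinity>"
proof -
  obtain R M where "\<And>y. R < \<bar>y\<bar> \<Longrightarrow> \<phi> y = 0" "\<And>y. \<bar>\<phi> y\<bar> \<le> M"
    using Cc_infty_puncturedE[OF assms] by metis
  then have "\<bar>(\<phi> y)\<^sup>2\<bar> \<le> M\<^sup>2 * indicator {-R..R} y" for y
    using power_mono[of "\<bar>\<phi> y\<bar>" M 2] by (cases "\<bar>y\<bar> \<le> R") (auto simp: indicator_def)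
  then show ?thesis by (rule nn_integral_bounded_support_finite)
qed

text \<open>Supplies the a priori finiteness required by \<open>hardy_of_finite\<close>: where
  \<phi> is nonzero, \<bar>y\<bar> \<ge> r keeps the weight below r^(-\<beta>).\<close>

lemma Cc_infty_punctured_weighted_L2:
  assumes "\<phi> \<in> Cc_infty_punctured" "0 < \<beta>"
  shows "(\<integral>\<^sup>+ y. ennreal ((\<phi> y)\<^sup>2 / \<bar>y\<bar> powr \<beta>) \<partial>lborel) < \<infinity>"
proof -
  obtain r R M where *: "0 < r" "\<And>y. \<bar>y\<bar> < r \<Longrightarrow> \<phi> y = 0" "\<And>y. R < \<bar>y\<bar> \<Longrightarrow> \<phi> y = 0" "\<And>y. \<bar>\<phi> y\<bar> \<le> M"
    using Cc_infty_puncturedE[OF assms(1)] by metis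
  have "\<bar>(\<phi> y)\<^sup>2 / \<bar>y\<bar> powr \<beta>\<bar> \<le> M\<^sup>2 / r powr \<beta> * indicator {-R..R} y" for y
  proof (cases "r \<le> \<bar>y\<bar> \<and> \<bar>y\<bar> \<le> R")
    case True
    have "(\<phi> y)\<^sup>2 / \<bar>y\<bar> powr \<beta> \<le> M\<^sup>2 / r powr \<beta>"
      using True * assms(2) power_mono[of "\<bar>\<phi> y\<bar>" M 2]
      by (intro frac_le powr_mono2) auto
    then show ?thesis using True by (auto simp: indicator_def)
  next
    case False
    then show ?thesis using * by (auto simp: indicator_def not_le)
  qed
  then show ?thesis by (rule nn_integral_bounded_support_finite)
qed

text \<open>This profile is the kernel times \<bar>h\<bar>^2 near 0, as a Lipschitz increment gives,
  and the bare kernel far away, up to constants. It is integrable at 0 because 1 - \<beta> > -1 and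
  at infinity because -1 - \<beta> < -1.\<close>

lemma nn_integral_kernel_profile_finite:
  fixes \<beta> :: real
  assumes \<beta>: "0 < \<beta>" "\<beta> < 2"
  shows "(\<integral>\<^sup>+ h. ennreal (if \<bar>h\<bar> \<le> 1 then \<bar>h\<bar> powr (1 - \<beta>) else \<bar>h\<bar> powr (- 1 - \<beta>)) \<partial>lborel) < \<infinity>"
proof -
  \<comment> \<open>A one-sided version, for the half-line integrals; g(h) + g(-h) dominates the
    profile. Both branches count at h = 1, which only enlarges the bound.\<close>
  define g where "g h = (if h \<in> {0..1} then h powr (1 - \<beta>) else 0) + (if h \<in> {1..} then h powr (- 1 - \<beta>) else 0)" for h :: real
  have g_nonneg: "0 \<le> g h" for h by (simp add: g_def)
  have [measurable]: "g \<in> borel_measurable borel"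
    unfolding g_def[abs_def] by measurable
  have near: "((\<lambda>h::real. if h \<in> {0..1} then h powr (1 - \<beta>) else 0) has_integral 1 powr (1 - \<beta> + 1) / (1 - \<beta> + 1)) UNIV"
    unfolding has_integral_restrict_UNIV using \<beta> by (intro has_integral_powr_from_0) auto
  have far: "((\<lambda>h::real. if h \<in> {1..} then h powr (- 1 - \<beta>) else 0) has_integral - (1 powr (- 1 - \<beta> + 1)) / (- 1 - \<beta> + 1)) UNIV"
    unfolding has_integral_restrict_UNIV using \<beta> by (intro has_integral_powr_to_inf) auto
  obtain I where "(g has_integral I) UNIV"
    using has_integral_add[OF near far] unfolding g_def[abs_def] by blast
  then have fin: "(\<integral>\<^sup>+ h. ennreal (g h) \<partial>lborel) < \<infinity>"
    using nn_integral_has_integral_lborel[of g I] g_nonneg by simp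
  have refl: "(\<integral>\<^sup>+ h. ennreal (g (- h)) \<partial>lborel) = (\<integral>\<^sup>+ h. ennreal (g h) \<partial>lborel)"
    using nn_integral_real_affine[of "\<lambda>h. ennreal (g h)" "-1" 0] by simp
  have "(\<integral>\<^sup>+ h. ennreal (if \<bar>h\<bar> \<le> 1 then \<bar>h\<bar> powr (1 - \<beta>) else \<bar>h\<bar> powr (- 1 - \<beta>)) \<partial>lborel)
      \<le> ennreal 1 * (\<integral>\<^sup>+ h. ennreal (g h) \<partial>lborel) + ennreal 1 * (\<integral>\<^sup>+ h. ennreal (g (- h)) \<partial>lborel)"
    by (intro nn_integral_le_lincomb) (auto simp: g_def)
  also have "\<dots> < \<infinity>" using fin refl by simp
  finally show ?thesis .
qed

text \<open>With y' = y + h the increment vanishes unless y or y + h lies in [-R, R]. Integrating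
  over y first therefore costs a factor 4 R, and the integral over h is that of the profile
  above.\<close>

lemma energy_Cc_infty_punctured_finite:
  assumes "\<phi> \<in> Cc_infty_punctured" and \<beta>: "0 < \<beta>" "\<beta> < 2"
  shows "energy \<beta> \<phi> < \<infinity>"
proof -
  note [measurable] = Cc_infty_punctured_measurable[OF assms(1)]
  obtain R M L where \<phi>: "0 < R" "0 \<le> M" "0 \<le> L"
    "\<And>y. R < \<bar>y\<bar> \<Longrightarrow> \<phi> y = 0" "\<And>y. \<bar>\<phi> y\<bar> \<le> M" "\<And>x y. \<bar>\<phi> x - \<phi> y\<bar> \<le> L * \<bar>x - y\<bar>"
    using Cc_infty_puncturedE[OF assms(1)] by metis
  let ?c = "c_const \<beta>"
  have c: "0 < ?c" using c_const_pos[OF \<beta>] .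
  \<comment> \<open>Covers both regimes: L^2 from the Lipschitz bound for \<bar>h\<bar> \<le> 1, and
    (2 M)^2 from the sup bound for larger \<bar>h\<bar>.\<close>
  define B where "B = L\<^sup>2 + 4 * M\<^sup>2"
  have B: "0 \<le> B" by (simp add: B_def)
  define k where "k h = (if \<bar>h\<bar> \<le> 1 then \<bar>h\<bar> powr (1 - \<beta>) else \<bar>h\<bar> powr (- 1 - \<beta>))" for h :: real
  have [measurable]: "k \<in> borel_measurable borel"
    unfolding k_def[abs_def] by measurable
  let ?s = "\<lambda>y. indicator {-R..R} y :: ennreal"
  have bound: "ennreal ((\<phi> (y + h) - \<phi> y)\<^sup>2 * q_kernel \<beta> h) \<le> ennreal (B * ?c * k h) * (?s y + ?s (y + h))"
    for y h
  proof (cases "\<bar>y\<bar> \<le> R \<or> \<bar>y + h\<bar> \<le> R")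
    case True
    have "(\<phi> (y + h) - \<phi> y)\<^sup>2 * \<bar>h\<bar> powr (- 1 - \<beta>) \<le> B * k h"
    proof (cases "\<bar>h\<bar> \<le> 1")
      case True
      have "(\<phi> (y + h) - \<phi> y)\<^sup>2 \<le> (L * \<bar>h\<bar>)\<^sup>2"
        using \<phi>(6)[of "y + h" y] by (intro abs_le_square_iff[THEN iffD1]) auto
      also have "\<dots> \<le> B * \<bar>h\<bar>\<^sup>2"
        by (auto simp: B_def power_mult_distrib intro!: mult_right_mono)
      finally have "(\<phi> (y + h) - \<phi> y)\<^sup>2 * \<bar>h\<bar> powr (- 1 - \<beta>) \<le> B * \<bar>h\<bar>\<^sup>2 * \<bar>h\<bar> powr (- 1 - \<beta>)"
        by (intro mult_right_mono) auto
      also have "\<bar>h\<bar>\<^sup>2 * \<bar>h\<bar> powr (- 1 - \<beta>) = \<bar>h\<bar> powr (1 - \<beta>)"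
      \<comment> \<open>At h = 0 both sides are 0, since \<open>0 powr a = 0\<close>.\<close>
      proof (cases "h = 0")
        case False
        then have "\<bar>h\<bar>\<^sup>2 = \<bar>h\<bar> powr 2" by simp
        then show ?thesis unfolding \<open>\<bar>h\<bar>\<^sup>2 = \<bar>h\<bar> powr 2\<close> powr_add [symmetric] by simp
      qed simp
      then have "B * \<bar>h\<bar>\<^sup>2 * \<bar>h\<bar> powr (- 1 - \<beta>) = B * k h"
        using True by (simp add: k_def mult.assoc)
      finally show ?thesis .
    next
      case False
      have "\<bar>\<phi> (y + h) - \<phi> y\<bar> \<le> 2 * M"
        using \<phi>(5)[of "y + h"] \<phi>(5)[of y] by linarith
      then have "(\<phi> (y + h) - \<phi> y)\<^sup>2 \<le> (2 * M)\<^sup>2"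
        using \<phi>(2) by (intro abs_le_square_iff[THEN iffD1]) auto
      also have "\<dots> \<le> B" by (simp add: B_def power_mult_distrib)
      finally show ?thesis
        using False by (auto simp: k_def intro!: mult_right_mono)
    qed
    from mult_left_mono[OF this, of ?c] have "(\<phi> (y + h) - \<phi> y)\<^sup>2 * q_kernel \<beta> h \<le> B * ?c * k h"
      using c by (simp add: q_kernel_def mult_ac)
    then have "ennreal ((\<phi> (y + h) - \<phi> y)\<^sup>2 * q_kernel \<beta> h) \<le> ennreal (B * ?c * k h) * 1"
      by (simp add: ennreal_leI)
    also have "\<dots> \<le> ennreal (B * ?c * k h) * (?s y + ?s (y + h))"
      using True by (intro mult_left_mono) (auto simp: indicator_def)
    finally show ?thesis .
  next
    case False
    then show ?thesis using \<phi>(4) by (auto simp: not_le)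
  qed
  have shift: "(\<integral>\<^sup>+ z. f z \<partial>lborel) = (\<integral>\<^sup>+ h. f (t + h) \<partial>lborel)"
    if "f \<in> borel_measurable borel" for t and f :: "real \<Rightarrow> ennreal"
    using nn_integral_real_affine[OF that, of 1 t] by simp
  have s: "(\<integral>\<^sup>+ y. ?s y + ?s (y + h) \<partial>lborel) = ennreal (4 * R)" for h
  proof -
    have "(\<integral>\<^sup>+ y. ?s (y + h) \<partial>lborel) = (\<integral>\<^sup>+ y. ?s y \<partial>lborel)"
      using shift[of ?s h] by (simp add: add.commute)
    then show ?thesis
      using \<phi>(1) by (simp add: nn_integral_add flip: ennreal_plus)
  qed
  have "(\<integral>\<^sup>+ y. \<integral>\<^sup>+ y'. ennreal ((\<phi> y' - \<phi> y)\<^sup>2 * q_kernel \<beta> (y' - y)) \<partial>lborel \<partial>lborel)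
      = (\<integral>\<^sup>+ y. \<integral>\<^sup>+ h. ennreal ((\<phi> (y + h) - \<phi> y)\<^sup>2 * q_kernel \<beta> h) \<partial>lborel \<partial>lborel)"
  proof (rule nn_integral_cong)
    fix y
    show "(\<integral>\<^sup>+ y'. ennreal ((\<phi> y' - \<phi> y)\<^sup>2 * q_kernel \<beta> (y' - y)) \<partial>lborel)
        = (\<integral>\<^sup>+ h. ennreal ((\<phi> (y + h) - \<phi> y)\<^sup>2 * q_kernel \<beta> h) \<partial>lborel)"
      using shift[of "\<lambda>y'. ennreal ((\<phi> y' - \<phi> y)\<^sup>2 * q_kernel \<beta> (y' - y))" y] by simp
  qed
  also have "\<dots> \<le> (\<integral>\<^sup>+ y. \<integral>\<^sup>+ h. ennreal (B * ?c * k h) * (?s y + ?s (y + h)) \<partial>lborel \<partial>lborel)"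
    by (intro nn_integral_mono bound)
  also have "\<dots> = (\<integral>\<^sup>+ h. \<integral>\<^sup>+ y. ennreal (B * ?c * k h) * (?s y + ?s (y + h)) \<partial>lborel \<partial>lborel)"
    by (rule lborel_pair.Fubini' [symmetric]) measurable
  also have "\<dots> = (\<integral>\<^sup>+ h. ennreal (B * ?c * k h) * ennreal (4 * R) \<partial>lborel)"
    by (simp add: nn_integral_cmult s)
  also have "\<dots> = ennreal (B * ?c) * (\<integral>\<^sup>+ h. ennreal (k h) \<partial>lborel) * ennreal (4 * R)"
    using B c by (simp add: nn_integral_cmult nn_integral_multc ennreal_mult' k_def)
  also have "\<dots> < \<infinity>"
    using nn_integral_kernel_profile_finite[OF \<beta>] by (simp add: k_def ennreal_mult_less_top)
  finally have "(\<integral>\<^sup>+ y. \<integral>\<^sup>+ y'. ennreal ((\<phi> y' - \<phi> y)\<^sup>2 * q_kernel \<beta> (y' - y)) \<partial>lborel \<partial>lborel) < top"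
    by simp
  moreover have "1 / 2 < (top :: ennreal)"
    by (simp add: less_top [symmetric] ennreal_divide_eq_top_iff)
  ultimately show ?thesis
    by (simp add: energy_iterated ennreal_mult_less_top)
qed

section \<open>From test functions to their closure\<close>

lemma hardy_Cc_infty_punctured:
  assumes "\<phi> \<in> Cc_infty_punctured" "0 < \<beta>" "\<beta> < 2" "\<beta> \<noteq> 1"
  shows "(\<integral>\<^sup>+ y. ennreal ((\<phi> y)\<^sup>2 / \<bar>y\<bar> powr \<beta>) \<partial>lborel)
    \<le> ennreal (288 / ((2 powr \<bar>\<beta> - 1\<bar> - 1)\<^sup>2 * c_const \<beta>)) * energy \<beta> \<phi>"
  using assms by (intro hardy_of_finite Cc_infty_punctured_measurable Cc_infty_punctured_weighted_L2)

text \<open>On \<open>H_space\<close> the integral and the energy are finite, so no default value of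
  \<open>LINT\<close> or \<open>enn2real\<close> enters \<open>H_norm\<close>, and its square
  dominates each of the two terms.\<close>

lemma H_norm_controls:
  assumes "0 < \<beta>" "\<beta> < 2" "w \<in> H_space \<beta>"
  shows "(\<integral>\<^sup>+ y. ennreal ((w y)\<^sup>2) \<partial>lborel) \<le> ennreal ((H_norm \<beta> w)\<^sup>2)"
    and "energy \<beta> w \<le> ennreal ((H_norm \<beta> w)\<^sup>2)"
proof -
  have int: "integrable lborel (\<lambda>y. (w y)\<^sup>2)" and fin: "energy \<beta> w < \<infinity>"
    using assms by (auto simp: H_space_def)
  have norm: "(H_norm \<beta> w)\<^sup>2 = (LINT y|lborel. (w y)\<^sup>2) + enn2real (energy \<beta> w)"
    by (simp add: H_norm_def)
  show "(\<integral>\<^sup>+ y. ennreal ((w y)\<^sup>2) \<partial>lborel) \<le> ennreal ((H_norm \<beta> w)\<^sup>2)"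
    unfolding norm by (simp add: nn_integral_eq_integral[OF int] ennreal_leI)
  have "energy \<beta> w = ennreal (enn2real (energy \<beta> w))"
    using fin by simp
  also have "\<dots> \<le> ennreal ((H_norm \<beta> w)\<^sup>2)"
    unfolding norm by (simp add: ennreal_leI)
  finally show "energy \<beta> w \<le> ennreal ((H_norm \<beta> w)\<^sup>2)" .
qed

lemma Cc_infty_punctured_subset_H_space:
  assumes "0 < \<beta>" "\<beta> < 2"
  shows "Cc_infty_punctured \<subseteq> H_space \<beta>"
  using assms Cc_infty_punctured_measurable energy_Cc_infty_punctured_finite Cc_infty_punctured_L2
  by (auto simp: H_space_def intro!: integrableI_nonneg)

lemma H_space_diff:
  assumes "0 < \<beta>" "\<beta> < 2" "u \<in> H_space \<beta>" "v \<in> H_space \<beta>"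
  shows "(\<lambda>y. u y - v y) \<in> H_space \<beta>"
proof -
  have [measurable]: "u \<in> borel_measurable borel" "v \<in> borel_measurable borel"
    using assms by (auto simp: H_space_def)
  have "integrable lborel (\<lambda>y. 2 * (u y)\<^sup>2 + 2 * (v y)\<^sup>2)"
    using assms by (auto simp: H_space_def)
  then have "integrable lborel (\<lambda>y. (u y - v y)\<^sup>2)"
    by (rule Bochner_Integration.integrable_bound) (auto intro!: AE_I2 simp: square_diff_le)
  moreover have "energy \<beta> (\<lambda>y. u y - v y) < \<infinity>"
    using assms by (intro le_less_trans[OF energy_diff_le]) (auto simp: H_space_def ennreal_mult_less_top)
  ultimately show ?thesis by (simp add: H_space_def)
qed

text \<open>The limits are taken in order: n to infinity at a fixed cutoff k, then k to infinity by
  monotone convergence. The constant is 1152 = 4 * 288, one factor 2 from splitting u = \<phi> n +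
  (u - \<phi> n) under the weight and one from splitting the energy of \<phi> n.\<close>

lemma hardy_H0_space:
  assumes \<beta>: "0 < \<beta>" "\<beta> < 2" "\<beta> \<noteq> 1" and u: "u \<in> H0_space \<beta>"
  shows "(\<integral>\<^sup>+ y. ennreal ((u y)\<^sup>2 / \<bar>y\<bar> powr \<beta>) \<partial>lborel)
    \<le> ennreal (1152 / ((2 powr \<bar>\<beta> - 1\<bar> - 1)\<^sup>2 * c_const \<beta>) * (H_norm \<beta> u)\<^sup>2)"
proof -
  obtain \<phi> where uH: "u \<in> H_space \<beta>" and \<phi>: "\<And>n. \<phi> n \<in> Cc_infty_punctured"
    and lim: "(\<lambda>n. H_norm \<beta> (\<lambda>y. u y - \<phi> n y)) \<longlonglongrightarrow> 0"
    using u by (auto simp: H0_space_def)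
  have \<phi>H: "\<phi> n \<in> H_space \<beta>" for n
    using Cc_infty_punctured_subset_H_space[OF \<beta>(1,2)] \<phi> by auto
  have [measurable]: "u \<in> borel_measurable borel" "\<phi> n \<in> borel_measurable borel" for n
    using uH \<phi>H by (auto simp: H_space_def)
  define d where "d n = H_norm \<beta> (\<lambda>y. u y - \<phi> n y)" for n
  define K where "K = 288 / ((2 powr \<bar>\<beta> - 1\<bar> - 1)\<^sup>2 * c_const \<beta>)"
  have K: "0 \<le> K" using c_const_pos[OF \<beta>(1,2)] by (simp add: K_def)
  have dH: "(\<lambda>y. u y - \<phi> n y) \<in> H_space \<beta>" for n
    by (rule H_space_diff[OF \<beta>(1,2) uH \<phi>H])
  have \<phi>_bound: "(\<integral>\<^sup>+ y. ennreal ((\<phi> n y)\<^sup>2 / \<bar>y\<bar> powr \<beta>) \<partial>lborel)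
      \<le> ennreal (K * (2 * (H_norm \<beta> u)\<^sup>2 + 2 * (d n)\<^sup>2))" for n
  proof -
    \<comment> \<open>In this form \<open>energy_diff_le\<close> bounds the energy of \<phi> n by
      that of u and the vanishing distance d n.\<close>
    have "energy \<beta> (\<phi> n) = energy \<beta> (\<lambda>y. u y - (u y - \<phi> n y))" by simp
    also have "\<dots> \<le> 2 * energy \<beta> u + 2 * energy \<beta> (\<lambda>y. u y - \<phi> n y)"
      using \<beta> by (intro energy_diff_le) auto
    also have "\<dots> \<le> 2 * ennreal ((H_norm \<beta> u)\<^sup>2) + 2 * ennreal ((d n)\<^sup>2)"
      unfolding d_def using \<beta> uH dH by (intro add_mono mult_left_mono H_norm_controls) auto
    also have "\<dots> = ennreal (2 * (H_norm \<beta> u)\<^sup>2 + 2 * (d n)\<^sup>2)"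
      by (simp add: ennreal_mult)
    finally have "ennreal K * energy \<beta> (\<phi> n) \<le> ennreal K * ennreal (2 * (H_norm \<beta> u)\<^sup>2 + 2 * (d n)\<^sup>2)"
      by (intro mult_left_mono) auto
    then show ?thesis
      using hardy_Cc_infty_punctured[OF \<phi>[of n] \<beta>] K
      by (simp add: K_def[symmetric] ennreal_mult order_trans)
  qed
  define A :: "nat \<Rightarrow> real set" where "A k = {y. 1 / (real k + 1) \<le> \<bar>y\<bar>}" for k
  have [measurable]: "A k \<in> sets borel" for k
    unfolding A_def by measurable
  have cut: "(\<integral>\<^sup>+ y. ennreal ((u y)\<^sup>2 / \<bar>y\<bar> powr \<beta> * indicator (A k) y) \<partial>lborel)
      \<le> ennreal (4 * K * (H_norm \<beta> u)\<^sup>2)" for k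
  proof -
    \<comment> \<open>The largest value of the weight on \<open>A k\<close>. It grows with k, but at
      fixed k it multiplies (d n)^2, which tends to 0.\<close>
    define w where "w = (real k + 1) powr \<beta>"
    have w: "0 \<le> w" by (simp add: w_def)
    have "(u y)\<^sup>2 / \<bar>y\<bar> powr \<beta> * indicator (A k) y
        \<le> 2 * ((\<phi> n y)\<^sup>2 / \<bar>y\<bar> powr \<beta>) + 2 * w * (u y - \<phi> n y)\<^sup>2" for n y
    proof (cases "y \<in> A k")
      case True
      have y: "1 / (real k + 1) \<le> \<bar>y\<bar>" using True by (simp add: A_def)
      have "(1 / (real k + 1)) powr \<beta> \<le> \<bar>y\<bar> powr \<beta>"
        using y \<beta> by (intro powr_mono2) auto
      then have "1 \<le> w * \<bar>y\<bar> powr \<beta>"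
        by (simp add: w_def powr_divide field_simps)
      moreover have "0 < \<bar>y\<bar> powr \<beta>"
        using less_le_trans[OF _ y, of 0] by simp
      ultimately have "(u y - \<phi> n y)\<^sup>2 / \<bar>y\<bar> powr \<beta> \<le> w * (u y - \<phi> n y)\<^sup>2"
        using mult_right_mono[of 1 "w * \<bar>y\<bar> powr \<beta>" "(u y - \<phi> n y)\<^sup>2"]
        by (simp add: pos_divide_le_eq mult_ac)
      moreover have "(u y)\<^sup>2 / \<bar>y\<bar> powr \<beta> \<le> (2 * (\<phi> n y)\<^sup>2 + 2 * (u y - \<phi> n y)\<^sup>2) / \<bar>y\<bar> powr \<beta>"
        using square_add_le[of "\<phi> n y" "u y - \<phi> n y"] by (intro divide_right_mono) auto
      ultimately show ?thesis
        using True by (simp add: add_divide_distrib)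
    qed (use w in simp)
    then have "(\<integral>\<^sup>+ y. ennreal ((u y)\<^sup>2 / \<bar>y\<bar> powr \<beta> * indicator (A k) y) \<partial>lborel)
        \<le> ennreal 2 * (\<integral>\<^sup>+ y. ennreal ((\<phi> n y)\<^sup>2 / \<bar>y\<bar> powr \<beta>) \<partial>lborel)
          + ennreal (2 * w) * (\<integral>\<^sup>+ y. ennreal ((u y - \<phi> n y)\<^sup>2) \<partial>lborel)" for n
      using w by (intro nn_integral_le_lincomb) auto
    also have "\<dots> n \<le> ennreal 2 * ennreal (K * (2 * (H_norm \<beta> u)\<^sup>2 + 2 * (d n)\<^sup>2))
          + ennreal (2 * w) * ennreal ((d n)\<^sup>2)" for n
      using \<phi>_bound[of n] H_norm_controls(1)[OF \<beta>(1,2) dH, of n]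
      by (intro add_mono mult_left_mono) (auto simp: d_def)
    also have "\<dots> n = ennreal (2 * (K * (2 * (H_norm \<beta> u)\<^sup>2 + 2 * (d n)\<^sup>2)) + 2 * w * (d n)\<^sup>2)" for n
      using K w by (simp add: ennreal_mult)
    finally have le: "(\<integral>\<^sup>+ y. ennreal ((u y)\<^sup>2 / \<bar>y\<bar> powr \<beta> * indicator (A k) y) \<partial>lborel)
        \<le> ennreal (2 * (K * (2 * (H_norm \<beta> u)\<^sup>2 + 2 * (d n)\<^sup>2)) + 2 * w * (d n)\<^sup>2)" for n .
    have "(\<lambda>n. ennreal (2 * (K * (2 * (H_norm \<beta> u)\<^sup>2 + 2 * (d n)\<^sup>2)) + 2 * w * (d n)\<^sup>2))
        \<longlonglongrightarrow> ennreal (2 * (K * (2 * (H_norm \<beta> u)\<^sup>2 + 2 * 0\<^sup>2)) + 2 * w * 0\<^sup>2)"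
      using lim unfolding d_def[symmetric] by (intro tendsto_intros)
    then have "(\<integral>\<^sup>+ y. ennreal ((u y)\<^sup>2 / \<bar>y\<bar> powr \<beta> * indicator (A k) y) \<partial>lborel)
        \<le> ennreal (2 * (K * (2 * (H_norm \<beta> u)\<^sup>2 + 2 * 0\<^sup>2)) + 2 * w * 0\<^sup>2)"
      by (rule LIMSEQ_le_const) (use le in auto)
    then show ?thesis by (simp add: mult.assoc)
  qed
  have "(\<lambda>k. \<integral>\<^sup>+ y. ennreal ((u y)\<^sup>2 / \<bar>y\<bar> powr \<beta> * indicator (A k) y) \<partial>lborel)
      \<longlonglongrightarrow> (\<integral>\<^sup>+ y. ennreal ((u y)\<^sup>2 / \<bar>y\<bar> powr \<beta>) \<partial>lborel)"
  proof (rule nn_integral_LIMSEQ)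
    have mono: "A k \<subseteq> A l" if "k \<le> l" for k l
    proof -
      have "1 / (real l + 1) \<le> 1 / (real k + 1)"
        using that by (intro divide_left_mono) auto
      then show ?thesis by (auto simp: A_def)
    qed
    then show "incseq (\<lambda>k y. ennreal ((u y)\<^sup>2 / \<bar>y\<bar> powr \<beta> * indicator (A k) y))"
      by (auto simp: incseq_def le_fun_def indicator_def intro!: ennreal_leI)
    fix y
    show "(\<lambda>k. ennreal ((u y)\<^sup>2 / \<bar>y\<bar> powr \<beta> * indicator (A k) y))
        \<longlonglongrightarrow> ennreal ((u y)\<^sup>2 / \<bar>y\<bar> powr \<beta>)"
    \<comment> \<open>The origin lies in no \<open>A k\<close>, but division by
      \<open>0 powr \<beta> = 0\<close> makes the integrand 0 there.\<close>
    proof (cases "y = 0")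
      case False
      obtain k where k: "1 / (real k + 1) < \<bar>y\<bar>"
        using False nat_approx_posE[of "\<bar>y\<bar>"] by (auto simp: add.commute)
      then have "y \<in> A l" if "k \<le> l" for l
        using mono[OF that] by (auto simp: A_def subset_iff)
      then have "eventually (\<lambda>l. ennreal ((u y)\<^sup>2 / \<bar>y\<bar> powr \<beta> * indicator (A l) y)
          = ennreal ((u y)\<^sup>2 / \<bar>y\<bar> powr \<beta>)) sequentially"
        by (auto intro!: eventually_sequentiallyI[of k])
      then show ?thesis by (rule tendsto_eventually)
    qed simp
  qed auto
  then have "(\<integral>\<^sup>+ y. ennreal ((u y)\<^sup>2 / \<bar>y\<bar> powr \<beta>) \<partial>lborel) \<le> ennreal (4 * K * (H_norm \<beta> u)\<^sup>2)"
    by (rule LIMSEQ_le_const2) (use cut in auto)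
  then show ?thesis by (simp add: K_def)
qed

section \<open>Choice of the constants and their local boundedness\<close>

theorem proposition6p2:
  shows "\<exists>C :: real \<Rightarrow> real.
    (\<forall>\<beta>. 0 < \<beta> \<and> \<beta> < 2 \<and> \<beta> \<noteq> 1 \<longrightarrow>
       0 < C \<beta> \<and>
       (\<forall>u \<in> H0_space \<beta>.
          (\<integral>\<^sup>+ y. ennreal ((u y)\<^sup>2 / \<bar>y\<bar> powr \<beta>) \<partial>lborel) \<le> ennreal (C \<beta> * (H_norm \<beta> u)\<^sup>2))) \<and>
    (\<forall>\<beta>0 \<beta>1. 1 < \<beta>0 \<and> \<beta>0 < \<beta>1 \<and> \<beta>1 < 2 \<longrightarrow> bdd_above (C ` {\<beta>0..\<beta>1}))"
proof (intro exI conjI allI impI ballI)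
  let ?C = "\<lambda>\<beta>. 1152 / ((2 powr \<bar>\<beta> - 1\<bar> - 1)\<^sup>2 * c_const \<beta>)"
  have nz: "(2 powr \<bar>\<beta> - 1\<bar> - 1)\<^sup>2 * c_const \<beta> > 0" if "0 < \<beta>" "\<beta> < 2" "\<beta> \<noteq> 1" for \<beta>
    using that c_const_pos[of \<beta>] by (intro mult_pos_pos) (auto simp: powr_eq_one_iff_gen)
  fix \<beta> :: real assume \<beta>: "0 < \<beta> \<and> \<beta> < 2 \<and> \<beta> \<noteq> 1"
  show "0 < ?C \<beta>" using \<beta> nz by (intro divide_pos_pos) auto
  show "(\<integral>\<^sup>+ y. ennreal ((u y)\<^sup>2 / \<bar>y\<bar> powr \<beta>) \<partial>lborel) \<le> ennreal (?C \<beta> * (H_norm \<beta> u)\<^sup>2)"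
    if "u \<in> H0_space \<beta>" for u
    using hardy_H0_space \<beta> that by blast
next
  let ?C = "\<lambda>\<beta>. 1152 / ((2 powr \<bar>\<beta> - 1\<bar> - 1)\<^sup>2 * c_const \<beta>)"
  fix \<beta>0 \<beta>1 :: real assume *: "1 < \<beta>0 \<and> \<beta>0 < \<beta>1 \<and> \<beta>1 < 2"
  have nz: "(2 powr \<bar>\<beta> - 1\<bar> - 1)\<^sup>2 * c_const \<beta> \<noteq> 0" if "\<beta> \<in> {\<beta>0..\<beta>1}" for \<beta>
    using that * c_const_pos[of \<beta>] by (auto simp: powr_eq_one_iff_gen)
  \<comment> \<open>The interval stays inside (1, 2), where neither factor of the denominator
    vanishes; compactness then gives the bound.\<close>
  have "continuous_on {\<beta>0..\<beta>1} ?C"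
    by (intro continuous_intros continuous_on_c_const) (use * nz in auto)
  then have "compact (?C ` {\<beta>0..\<beta>1})"
    by (rule compact_continuous_image) simp
  then show "bdd_above (?C ` {\<beta>0..\<beta>1})"
    by (intro bounded_imp_bdd_above compact_imp_bounded)
qed
end
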